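(* Let $\varphi_5:\mathbb{N}\to\mathbb{N}$ be the function defined as follows. The values $\varphi_5(0),\varphi_5(1),\dots,\varphi_5(29)$ are, in order, $$5,4,6,7,1,0,2,3,11,10,\ 9,8,15,14,13,12,19,18,17,16,\ 23,22,21,20,27,26,25,24,29,28,$$ and for $x\ge 30$, $\varphi_5(x)=x\oplus_2 3$. Then, for all nonnegative integers $a,b$, the Halve Nim position $a^1b^15^1$ is a $\mathcal{P}$-position if and only if $b=\varphi_5(a)$. Furthermore, for $a,b\ge 30$, $a^1b^15^1$ is a $\mathcal{P}$-position if and only if $(a+2)\oplus(b+2)=3$.
   Context: $\mathbb{N}$ is the set of nonnegative integers and $\oplus$ denotes bitwise XOR. The $n$-shifted bitwise sum is $x\oplus_n y=\bigl((x+n)\oplus y\bigr)-n$. Halve Nim is a two-player game played on finitely many piles of coins; players alternate moves and a player who cannot move loses. A move is one of: (i) choose one pile and remove at least one coin from it; (ii) halve the game: simultaneously replace every pile of $m$ coins by a pile of $\lfloor m/2\rfloor$ coins. When there are no coins left, no move is available (halving requires at least one coin to be present). A position is a $\mathcal{P}$-position if the player who is not about to move has a winning strategy (equivalently, every move from it leads to an $\mathcal{N}$-position), and an $\mathcal{N}$-position if the player about to move has a winning strategy. $a^1b^1c^1$ denotes the position with three piles of sizes $a$, $b$, $c$ (a pile of size $0$ is an empty pile); in particular $a^1b^15^1$ has piles of sizes $a$, $b$, $5$. *)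

theory Defs
  imports Complex_Main "HOL-Library.Multiset"
begin

text \<open>
  A position is the multiset of its pile sizes; empty piles may be present, as elements \<open>0\<close>.
\<close>

type_synonym position = "nat multiset"

inductive halve_nim_move :: "position \<Rightarrow> position \<Rightarrow> bool" where
  remove: "k < m \<Longrightarrow> halve_nim_move (add_mset m M) (add_mset k M)"
| halve: "\<exists>m \<in># M. 0 < m \<Longrightarrow> halve_nim_move M (image_mset (\<lambda>m. m div 2) M)"

text \<open>
  Both predicates are least fixed points, so membership means that the player in question can
  force a win in finitely many moves; a position without moves is a \<open>\<P>\<close>-position.
\<close>

inductive P_position :: "position \<Rightarrow> bool" and N_position :: "position \<Rightarrow> bool" where
  P_positionI: "(\<And>M'. halve_nim_move M M' \<Longrightarrow> N_position M') \<Longrightarrow> P_position M"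
| N_positionI: "halve_nim_move M M' \<Longrightarrow> P_position M' \<Longrightarrow> N_position M"

text \<open>
  The shifted bitwise sum is integer-valued, since for small arguments the final subtraction can
  leave the natural numbers: \<open>shifted_xor 2 0 3 = - 1\<close>.
\<close>

definition shifted_xor :: "nat \<Rightarrow> nat \<Rightarrow> nat \<Rightarrow> int" where
  "shifted_xor n x y = int (xor (x + n) y) - int n"

text \<open>
  The conversion \<open>nat\<close> never truncates here, see \<open>int_phi5\<close>.
\<close>

definition phi5 :: "nat \<Rightarrow> nat" where
  "phi5 x =
    (if x < 30 then
       [5, 4, 6, 7, 1, 0, 2, 3, 11, 10,
        9, 8, 15, 14, 13, 12, 19, 18, 17, 16,
        23, 22, 21, 20, 27, 26, 25, 24, 29, 28] ! x
     else nat (shifted_xor 2 x 3))"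

lemma int_phi5:
  assumes "30 \<le> x"
  shows "int (phi5 x) = shifted_xor 2 x 3"
proof -
  have "xor (x + 2) 3 div 4 = (x + 2) div 4"
    using drop_bit_xor[of 2 "x + 2" 3] by (simp add: drop_bit_eq_div del: add_2_eq_Suc')
  moreover have "8 \<le> (x + 2) div 4"
    using assms by linarith
  ultimately have "2 \<le> xor (x + 2) 3"
    by linarith
  with assms show ?thesis
    by (simp add: phi5_def shifted_xor_def)
qed

end

theory Submission
  imports Defs "HOL-Library.Code_Binary_Nat" (* unary naturals would make code_simp far too slow *)
begin

text \<open>
  The \<open>\<P>\<close>-positions with third pile \<open>c\<close> are determined for all \<open>c \<le> 5\<close> simultaneously: they form the
  graph of an involution \<open>phi c\<close>, and \<open>phi 0, \<dots>, phi 5\<close> is the unique family satisfying the mex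
  condition \<open>phi_mex\<close>. For large \<open>a\<close> the values \<open>phi 0 a, \<dots>, phi 3 a\<close> exhaust the block of four
  numbers containing \<open>a\<close>, in the order of ordinary Nim or with \<open>c\<close> replaced by \<open>c \<oplus> 2\<close>. The order
  alternates each time \<open>a\<close> doubles, which is why halving never leads from one of these positions to
  another. The values \<open>phi 4 a\<close> and \<open>phi 5 a\<close> lie in a neighbouring block; their halves differ from
  \<open>a div 2\<close> by one, while \<open>phi 2\<close> preserves parity. Small \<open>a\<close> are checked by evaluation.
\<close>

text \<open>
  The argument is the index \<open>a div 4\<close> of a block. From 7 onwards, \<open>level q\<close> says that
  \<open>k\<close> is even in \<open>7 * 2 ^ k \<le> q < 7 * 2 ^ (k + 1)\<close>; smaller arguments are not used.
\<close>

fun level :: "nat \<Rightarrow> bool" where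
  "level q = (if q < 14 then True else \<not> level (q div 2))"

declare level.simps [simp del]

definition shift :: "nat \<Rightarrow> nat \<Rightarrow> nat" where
  "shift c q = (if level q then xor c 2 else c)"

definition phi_table :: "nat list list" where
  "phi_table =
     [[0, 2, 1, 3, 4, 5, 8, 9, 6, 7, 12, 13, 10, 11, 14,
       15, 16, 17, 18, 19, 20, 21, 22, 23, 24, 25, 26, 27, 30, 31],
      [2, 3, 0, 1, 5, 4, 9, 8, 7, 6, 13, 12, 11, 10, 15,
       14, 17, 16, 19, 18, 21, 20, 23, 22, 25, 24, 27, 26, 31, 30],
      [1, 0, 2, 4, 3, 6, 5, 7, 8, 9, 10, 11, 12, 13, 18,
       19, 20, 21, 14, 15, 16, 17, 26, 27, 28, 29, 22, 23, 24, 25],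
      [3, 1, 4, 0, 2, 7, 6, 5, 9, 8, 11, 10, 13, 12, 19,
       18, 21, 20, 15, 14, 17, 16, 27, 26, 29, 28, 23, 22, 25, 24],
      [4, 5, 3, 2, 0, 1, 7, 6, 10, 11, 8, 9, 14, 15, 12,
       13, 18, 19, 16, 17, 22, 23, 20, 21, 26, 27, 24, 25, 28, 29],
      [5, 4, 6, 7, 1, 0, 2, 3, 11, 10, 9, 8, 15, 14, 13,
       12, 19, 18, 17, 16, 23, 22, 21, 20, 27, 26, 25, 24, 29, 28]]"

text \<open>The table lists the values of the mex recursion. Only the indices \<open>c < 6\<close> are meaningful.\<close>

definition phi :: "nat \<Rightarrow> nat \<Rightarrow> nat" where
  "phi c x =
     (if x < 30 then phi_table ! c ! x
      else if c < 4 then xor x (shift c (x div 4))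
      else xor (x + 2) (c - 2) - 2)"


section \<open>XOR and blocks of four numbers\<close>

lemma less_4_cases: "r < 4 \<Longrightarrow> r = 0 \<or> r = 1 \<or> r = 2 \<or> r = (3::nat)"
  by linarith

lemma xor_div_4:
  fixes x k :: nat
  assumes "k < 4"
  shows "xor x k div 4 = x div 4"
  using drop_bit_xor[of 2 x k] assms by (simp add: drop_bit_eq_div)

lemma xor_mod_4:
  fixes x k :: nat
  shows "xor x k mod 4 = xor (x mod 4) (k mod 4)"
  using take_bit_xor[of 2 x k] by (simp add: take_bit_eq_mod)

lemma xor_block:
  fixes q r k :: nat
  assumes "k < 4"
  shows "xor (4 * q + r) k = 4 * q + xor r k"
proof -
  have "xor (4 * q + r) k = 4 * (xor (4 * q + r) k div 4) + xor (4 * q + r) k mod 4"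
    by simp
  also have "\<dots> = 4 * (q + xor r k div 4) + xor r k mod 4"
    using assms by (simp only: xor_div_4 xor_mod_4) simp
  also have "\<dots> = 4 * q + xor r k"
    by simp
  finally show ?thesis .
qed

lemma xor_div_2:
  fixes x k :: nat
  shows "xor x k div 2 = xor (x div 2) (k div 2)"
  using drop_bit_xor[of 1 x k] by (simp add: drop_bit_eq_div)

lemma xor_left_cancel: "xor x k = xor x l \<longleftrightarrow> k = (l::nat)"
  by (metis xor.assoc xor.left_neutral xor_self_eq)

lemma xor_less_4: "r < 4 \<Longrightarrow> k < 4 \<Longrightarrow> xor r k < (4::nat)"
  by (auto dest!: less_4_cases)

section \<open>Values of \<open>phi\<close> beyond the table\<close>

lemma shift_less_4: "c < 4 \<Longrightarrow> shift c q < 4"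
  by (simp add: shift_def xor_less_4)

lemma shift_shift: "shift (shift c q) q = c"
  by (simp add: shift_def xor.assoc)

lemma phi_low: "30 \<le> a \<Longrightarrow> c < 4 \<Longrightarrow> phi c a = xor a (shift c (a div 4))"
  by (simp add: phi_def)

lemma phi_low_div_4: "30 \<le> a \<Longrightarrow> c < 4 \<Longrightarrow> phi c a div 4 = a div 4"
  by (simp add: phi_low xor_div_4 shift_less_4)

text \<open>\<open>shift\<close> is self-inverse for a fixed block, so applying it to
  \<open>xor a b\<close> yields the row.\<close>

lemma phi_low_surj:
  assumes "30 \<le> a" "b div 4 = a div 4"
  obtains d where "d < 4" "phi d a = b"
proof
  have "xor a b div 4 = 0"
    using drop_bit_xor[of 2 a b] assms(2) by (simp add: drop_bit_eq_div)
  then have "xor a b < 4" by linarith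
  then show *: "shift (xor a b) (a div 4) < 4" by (rule shift_less_4)
  show "phi (shift (xor a b) (a div 4)) a = b"
    using * assms(1) by (simp add: phi_low shift_shift flip: xor.assoc)
qed

lemma phi_high: "30 \<le> a \<Longrightarrow> 4 \<le> c \<Longrightarrow> phi c a = xor (a + 2) (c - 2) - 2"
  by (simp add: phi_def)

text \<open>XOR with 2 or 3 swaps the halves of a block of four. Adding 2 first moves the block
  boundaries, so the swap reads off from \<open>a mod 4\<close> as a translation.\<close>

lemma phi_4_5:
  assumes "30 \<le> a"
  shows "phi 4 a = (if a mod 4 < 2 then a - 2 else a + 2)"
    "phi 5 a = (if a mod 4 = 0 then a - 1 else if a mod 4 = 1 then a - 3
       else if a mod 4 = 2 then a + 3 else a + 1)"
proof -
  define q where "q = (a + 2) div 4"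
  define s where "s = (a + 2) mod 4"
  have a: "a + 2 = 4 * q + s" "s < 4" "8 \<le> q"
    using assms by (simp_all add: q_def s_def)
  have s: "s = 0 \<and> a mod 4 = 2 \<or> s = 1 \<and> a mod 4 = 3 \<or>
      s = 2 \<and> a mod 4 = 0 \<or> s = 3 \<and> a mod 4 = 1"
    unfolding s_def by presburger
  have "xor (a + 2) k = 4 * q + xor s k" if "k < 4" for k
    unfolding a(1) using that by (rule xor_block)
  from this[of 2] this[of 3]
  have p: "phi 4 a = 4 * q + xor s 2 - 2" "phi 5 a = 4 * q + xor s 3 - 2"
    using assms by (simp_all add: phi_high)
  show "phi 4 a = (if a mod 4 < 2 then a - 2 else a + 2)"
    using s p(1) a by (elim disjE conjE) simp_all
  show "phi 5 a = (if a mod 4 = 0 then a - 1 else if a mod 4 = 1 then a - 3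
       else if a mod 4 = 2 then a + 3 else a + 1)"
    using s p(2) a by (elim disjE conjE) simp_all
qed

text \<open>The blocks offset by 2 straddle the boundaries of the ordinary ones, and rows 4 and 5
  swap their halves.\<close>

lemma phi_high_div:
  assumes "30 \<le> a" "c = 4 \<or> c = 5"
  shows "phi c a div 2 = (if even (a div 2) then a div 2 - 1 else a div 2 + 1)"
    and "phi c a div 4 \<noteq> a div 4"
proof -
  define p where "p = a div 4 - 1"
  have a: "a = 4 * (p + 1) + a mod 4" "a div 4 = p + 1"
    using assms(1) mult_div_mod_eq[of 4 a] by (simp_all add: p_def)
  consider "a mod 4 = 0" "a = 4 * p + 4" | "a mod 4 = 1" "a = 4 * p + 5"
    | "a mod 4 = 2" "a = 4 * p + 6" | "a mod 4 = 3" "a = 4 * p + 7"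
    using less_4_cases[of "a mod 4"] a(1) by fastforce
  then have "(phi c a = 4 * p + 2 \<or> phi c a = 4 * p + 3) \<and> a div 2 = 2 * p + 2 \<or>
      (phi c a = 4 * p + 8 \<or> phi c a = 4 * p + 9) \<and> a div 2 = 2 * p + 3"
  proof cases
    case 1
    have "phi 4 a = a - 2" "phi 5 a = a - 1"
      using phi_4_5[OF assms(1)] unfolding 1(1) by simp_all
    with 1(2) assms(2) show ?thesis by auto
  next
    case 2
    have "phi 4 a = a - 2" "phi 5 a = a - 3"
      using phi_4_5[OF assms(1)] unfolding 2(1) by simp_all
    with 2(2) assms(2) show ?thesis by auto
  next
    case 3
    have "phi 4 a = a + 2" "phi 5 a = a + 3"
      using phi_4_5[OF assms(1)] unfolding 3(1) by simp_all
    with 3(2) assms(2) show ?thesis by auto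
  next
    case 4
    have "phi 4 a = a + 2" "phi 5 a = a + 1"
      using phi_4_5[OF assms(1)] unfolding 4(1) by simp_all
    with 4(2) assms(2) show ?thesis by auto
  qed
  then have "phi c a div 2 = 2 * p + 1 \<and> phi c a div 4 = p \<and> a div 2 = 2 * p + 2 \<or>
      phi c a div 2 = 2 * p + 4 \<and> phi c a div 4 = p + 2 \<and> a div 2 = 2 * p + 3"
    by auto
  then show "phi c a div 2 = (if even (a div 2) then a div 2 - 1 else a div 2 + 1)"
    "phi c a div 4 \<noteq> a div 4"
    using a(2) by auto
qed

section \<open>No move joins two points of the graphs\<close>

lemma phi_phi:
  assumes "c < 6"
  shows "phi c (phi c a) = a"
proof (cases "a < 32")
  case True
  \<comment> \<open>The block 28, ..., 31 straddles the end of the table, so 30 and 31 are evaluated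
    as well.\<close>
  have "list_all (\<lambda>a. list_all (\<lambda>c. phi c (phi c a) = a) [0..<6]) [0..<32]"
    by code_simp
  with True assms show ?thesis
    by (simp add: list_all_iff)
next
  case False
  show ?thesis
  proof (cases "c < 4")
    case True
    have "phi c a div 4 = a div 4"
      using False True by (intro phi_low_div_4) auto
    moreover have "8 \<le> a div 4" using False by simp
    ultimately have "phi c a div 4 = a div 4" "30 \<le> phi c a" by linarith+
    then show ?thesis
      using False True by (simp add: phi_low xor.assoc)
  next
    case False': False
    have "xor (a + 2) (c - 2) div 4 = (a + 2) div 4"
      using assms by (intro xor_div_4) simp
    moreover have "8 \<le> (a + 2) div 4"
      using False by simp
    ultimately have "32 \<le> xor (a + 2) (c - 2)"
      by linarith
    then show ?thesis
      using False False' by (simp add: phi_high xor.assoc del: add_2_eq_Suc')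
  qed
qed

lemma phi_distinct:
  assumes "c < 6" "d < c"
  shows "phi d a \<noteq> phi c a"
proof (cases "a < 30")
  case True
  have "list_all (\<lambda>a. list_all (\<lambda>c. list_all (\<lambda>d. phi d a \<noteq> phi c a) [0..<c]) [0..<6]) [0..<30]"
    by code_simp
  with True assms show ?thesis
    by (simp add: list_all_iff)
next
  case False
  consider "c < 4" | "d < 4" "c = 4 \<or> c = 5" | "d = 4" "c = 5"
    using assms by linarith
  then show ?thesis
  proof cases
    case 1
    have "shift d (a div 4) \<noteq> shift c (a div 4)"
      using assms(2) by (metis shift_shift nat_neq_iff)
    with 1 False assms(2) show ?thesis
      by (simp add: phi_low xor_left_cancel)
  next
    case 2
    then show ?thesis
      using phi_low_div_4[of a d] phi_high_div(2)[of a c] False by auto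
  next
    case 3
    then show ?thesis
      using False by (auto simp: phi_4_5)
  qed
qed

lemma level_half:
  assumes "60 \<le> a"
  shows "level (a div 2 div 4) \<longleftrightarrow> \<not> level (a div 4)"
proof -
  have "a div 2 div 4 = a div 4 div 2"
    by (simp flip: div_mult2_eq)
  moreover have "\<not> a div 4 < 14"
    using assms by linarith
  ultimately show ?thesis
    using level.simps[of "a div 4"] by simp
qed

lemma phi_halve:
  assumes "c < 6" "0 < a \<or> 0 < c"
  shows "phi (c div 2) (a div 2) \<noteq> phi c a div 2"
proof (cases "a < 60")
  case True
  \<comment> \<open>From 60 onwards the half of \<open>a\<close> is beyond the table too.\<close>
  have "list_all (\<lambda>a. list_all (\<lambda>c. (a, c) = (0, 0) \<or>
      phi (c div 2) (a div 2) \<noteq> phi c a div 2) [0..<6]) [0..<60]"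
    by code_simp
  then have "(a, c) = (0, 0) \<or> phi (c div 2) (a div 2) \<noteq> phi c a div 2"
    using True assms(1) by (simp add: list_all_iff)
  with assms(2) show ?thesis
    by blast
next
  case False
  then have a: "60 \<le> a" "30 \<le> a" "30 \<le> a div 2" by auto
  show ?thesis
  proof (cases "c < 4")
    case True
    \<comment> \<open>Exactly one side carries the correction by 2: it changes the left side by 2,
      or the right side, being halved, by 1.\<close>
    have "shift (c div 2) (a div 2 div 4) \<noteq> shift c (a div 4) div 2"
      using less_4_cases[OF True] level_half[OF a(1)] by (auto simp: shift_def)
    then show ?thesis
      using True a by (simp add: phi_low xor_div_2 xor_left_cancel)
  next
    case False
    then have c: "c = 4 \<or> c = 5" using assms(1) by linarith
    then have "c div 2 = 2" by auto
    \<comment> \<open>Row 2 is XOR with 0 or 2, whereas rows 4 and 5 change the parity of the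
      half.\<close>
    moreover have "even (phi 2 (a div 2)) \<longleftrightarrow> even (a div 2)"
      using a by (simp add: phi_low shift_def even_xor_iff)
    ultimately show ?thesis
      using phi_high_div(1)[OF a(2) c] a by auto
  qed
qed

section \<open>Every point off the graphs has a move onto them\<close>

lemma nim_shift_cover:
  fixes r s c :: nat
  assumes "r < 4" "s < 4" "c < 4" "s < xor r (xor c 2)" "r < xor s (xor c 2)"
  shows "(\<exists>d<c. xor r (xor d 2) = s) \<or> xor (r div 2) (c div 2) = s div 2"
proof -
  have "list_all (\<lambda>r. list_all (\<lambda>s. list_all (\<lambda>c.
      s < xor r (xor c 2) \<longrightarrow> r < xor s (xor c 2) \<longrightarrow>
      list_ex (\<lambda>d. xor r (xor d 2) = s) [0..<c] \<or> xor (r div 2) (c div 2) = s div 2)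
      [0..<4]) [0..<4]) [0..<4::nat]"
    by code_simp
  then have "list_ex (\<lambda>d. xor r (xor d 2) = s) [0..<c] \<or> xor (r div 2) (c div 2) = s div 2"
    using assms by (simp add: list_all_iff)
  then show ?thesis
    by (auto simp: list_ex_iff)
qed

text \<open>This is the mex property of XOR in ordinary Nim, on two-bit numbers; halving is required
  only in the order 2, 3, 0, 1 of \<open>nim_shift_cover\<close>.\<close>

lemma nim_cover:
  fixes r s c :: nat
  assumes "r < 4" "s < 4" "c < 4" "s < xor r c" "r < xor s c"
  shows "\<exists>d<c. xor r d = s"
proof -
  have "list_all (\<lambda>r. list_all (\<lambda>s. list_all (\<lambda>c.
      s < xor r c \<longrightarrow> r < xor s c \<longrightarrow> list_ex (\<lambda>d. xor r d = s) [0..<c]) [0..<4]) [0..<4]) [0..<4::nat]"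
    by code_simp
  then have "list_ex (\<lambda>d. xor r d = s) [0..<c]"
    using assms by (simp add: list_all_iff)
  then show ?thesis
    by (auto simp: list_ex_iff)
qed

lemma phi_cover_low:
  assumes "60 \<le> a" "c < 4" "b div 4 = a div 4" "b < phi c a" "a < phi c b"
  shows "(\<exists>d<c. phi d a = b) \<or> phi (c div 2) (a div 2) = b div 2"
proof -
  define q where "q = a div 4"
  define r where "r = a mod 4"
  define s where "s = b mod 4"
  have a: "a = 4 * q + r" "a div 4 = q" "r < 4"
    by (simp_all add: q_def r_def)
  have b: "b = 4 * q + s" "b div 4 = q" "s < 4"
    using assms(3) mult_div_mod_eq[of 4 b] by (simp_all add: q_def s_def)
  have h: "30 \<le> a" "30 \<le> b" "30 \<le> a div 2"
    using assms(1,3) by linarith+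
  have phi_a: "phi d a = 4 * q + xor r (shift d q)" if "d < 4" for d
    using phi_low[OF h(1) that] xor_block[OF shift_less_4[OF that]] a by simp
  have phi_b: "phi d b = 4 * q + xor s (shift d q)" if "d < 4" for d
    using phi_low[OF h(2) that] xor_block[OF shift_less_4[OF that]] b by simp
  have lt: "s < xor r (shift c q)" "r < xor s (shift c q)"
    using assms(4,5) a(1) b(1) phi_a[OF assms(2)] phi_b[OF assms(2)] by linarith+
  show ?thesis
  proof (cases "level q")
    case True
    have "(\<exists>d<c. xor r (xor d 2) = s) \<or> xor (r div 2) (c div 2) = s div 2"
      using lt True a b assms(2) by (intro nim_shift_cover) (auto simp: shift_def)
    then show ?thesis
    proof
      assume "\<exists>d<c. xor r (xor d 2) = s"
      then show ?thesis
        using True phi_a b(1) assms(2) by (auto simp: shift_def)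
    next
      assume *: "xor (r div 2) (c div 2) = s div 2"
      \<comment> \<open>The half has the opposite level, hence the ordinary Nim order.\<close>
      have "phi (c div 2) (a div 2) = xor (a div 2) (c div 2)"
        using level_half[OF assms(1)] True a(2) assms(2) h(3) by (simp add: phi_low shift_def)
      also have "\<dots> = xor a c div 2"
        by (simp add: xor_div_2)
      also have "\<dots> = (4 * q + xor r c) div 2"
        using xor_block[OF assms(2)] a(1) by simp
      also have "\<dots> = 2 * q + xor r c div 2"
        by simp
      also have "\<dots> = b div 2"
        using * b(1) by (simp add: xor_div_2)
      finally show ?thesis ..
    qed
  next
    case False
    then have "\<exists>d<c. xor r d = s"
      using lt a b assms(2) by (intro nim_cover) (auto simp: shift_def)
    then show ?thesis
      using False phi_a b(1) assms(2) by (auto simp: shift_def)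
  qed
qed

text \<open>The two strict bounds say that neither of the first two piles can be lowered onto row
  \<open>c\<close>; lowering \<open>c\<close> or halving must then succeed.\<close>

lemma phi_cover:
  assumes "c < 6" "a \<le> b" "b < phi c a" "a < phi c b"
  shows "(\<exists>d<c. phi d a = b) \<or> phi (c div 2) (a div 2) = b div 2"
proof (cases "a < 60")
  case True
  have "list_all (\<lambda>a. list_all (\<lambda>c. list_all (\<lambda>b. phi c b \<le> a \<or>
      list_ex (\<lambda>d. phi d a = b) [0..<c] \<or> phi (c div 2) (a div 2) = b div 2)
      [a..<phi c a]) [0..<6]) [0..<60]"
    by code_simp
  then have "phi c b \<le> a \<or> list_ex (\<lambda>d. phi d a = b) [0..<c] \<or> phi (c div 2) (a div 2) = b div 2"
    using True assms(1-3) by (simp add: list_all_iff)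
  with assms(4) show ?thesis
    by (auto simp: list_ex_iff)
next
  case False
  then have a: "60 \<le> a" "30 \<le> a" "30 \<le> b" using assms(2) by auto
  show ?thesis
  proof (cases "c < 4")
    case True
    have "b div 4 = a div 4"
      using phi_low_div_4[OF a(2) True] assms(2,3) by (metis div_le_mono le_antisym less_imp_le)
    with True a(1) assms show ?thesis
      by (intro phi_cover_low)
  next
    case False
    then have c: "c = 4 \<or> c = 5" using assms(1) by linarith
    show ?thesis
    proof (cases "b div 4 = a div 4")
      case True
      then obtain d where "d < 4" "phi d a = b"
        using phi_low_surj a(2) by blast
      moreover from this False have "d < c" by simp
      ultimately show ?thesis by blast
    next
      case block: False
      define q where "q = a div 4"
      have "a div 4 < b div 4"
        using block div_le_mono[OF assms(2), of 4] by linarith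
      then have b: "4 * q + 4 \<le> b"
        unfolding q_def by linarith
      have mod: "a mod 4 = 0 \<and> a = 4 * q \<or> a mod 4 = 1 \<and> a = 4 * q + 1 \<or>
          a mod 4 = 2 \<and> a = 4 * q + 2 \<or> a mod 4 = 3 \<and> a = 4 * q + 3"
        using less_4_cases[of "a mod 4"] mult_div_mod_eq[of 4 a] by (fastforce simp: q_def)
      \<comment> \<open>Above the block of \<open>a\<close>, only \<open>4 * q + 4\<close> can lie
        below \<open>phi c a\<close>. For \<open>c = 4\<close> the bound \<open>a < phi c b\<close>
        excludes it; for \<open>c = 5\<close> row 4 attains it.\<close>
      have "c = 5 \<and> b = a + 2 \<and> a mod 4 = 2"
        using c
      proof
        assume [simp]: "c = 4"
        have "a = 4 * q + 3" "b = 4 * (q + 1)"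
          using assms(3) phi_4_5(1)[OF a(2)] mod b by auto
        then show ?thesis
          using assms(4) phi_4_5(1)[OF a(3)] by simp
      next
        assume [simp]: "c = 5"
        show ?thesis
          using assms(3) phi_4_5(2)[OF a(2)] mod b by auto
      qed
      then show ?thesis
        using phi_4_5(1)[OF a(2)] by (intro disjI1 exI[of _ 4]) auto
    qed
  qed
qed

text \<open>The four conditions correspond to the four kinds of move; the guard reflects that
  halving needs a coin.\<close>

lemma phi_mex:
  assumes "c < 6"
  shows "b = phi c a \<longleftrightarrow>
     (\<forall>k<a. b \<noteq> phi c k) \<and> (\<forall>k<b. k \<noteq> phi c a) \<and> (\<forall>k<c. b \<noteq> phi k a) \<and>
     (0 < a \<or> 0 < b \<or> 0 < c \<longrightarrow> b div 2 \<noteq> phi (c div 2) (a div 2))"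
    (is "_ \<longleftrightarrow> ?R")
proof
  assume b: "b = phi c a"
  \<comment> \<open>This rules out \<open>b\<close> as the only nonempty pile, as
    \<open>phi_halve\<close> requires.\<close>
  have "phi 0 0 = 0"
    by (simp add: phi_def phi_table_def)
  with b assms have "0 < a \<or> 0 < c" if "0 < a \<or> 0 < b \<or> 0 < c"
    using that by (cases "a = 0 \<and> c = 0") auto
  with b assms show ?R
    using phi_halve[of c a] phi_distinct[of c _ a] phi_phi[of c] by (metis nat_neq_iff)
next
  assume R: ?R
  show "b = phi c a"
  proof (rule ccontr)
    assume "b \<noteq> phi c a"
    with R have *: "b < phi c a" by (metis nat_neq_iff)
    moreover have "phi c b \<noteq> a" "\<not> phi c b < a"
      using R phi_phi[OF assms] \<open>b \<noteq> phi c a\<close> by metis+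
    ultimately have lt: "a < phi c b" by simp
    have pos: "0 < a \<or> 0 < b \<or> 0 < c"
      using * by (auto intro!: gr0I simp: phi_def phi_table_def)
    consider "a \<le> b" | "b \<le> a" by linarith
    then show False
    proof cases
      case 1
      then show ?thesis
        using phi_cover[OF assms 1 * lt] R pos by metis
    next
      case 2
      have "(\<exists>d<c. phi d b = a) \<or> phi (c div 2) (b div 2) = a div 2"
        using phi_cover[OF assms 2 lt *] .
      \<comment> \<open>Each row is an involution, so the roles of \<open>a\<close> and
        \<open>b\<close> can be exchanged.\<close>
      then have "(\<exists>d<c. b = phi d a) \<or> b div 2 = phi (c div 2) (a div 2)"
        using phi_phi assms by (metis div_le_dividend le_less_trans less_trans)
      with R pos show ?thesis by blast
    qed
  qed
qed

section \<open>Halve Nim with three piles\<close>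

lemma halve_nim_move_triple:
  "halve_nim_move {#a, b, c#} M' \<longleftrightarrow>
     (\<exists>k<a. M' = {#k, b, c#}) \<or> (\<exists>k<b. M' = {#a, k, c#}) \<or> (\<exists>k<c. M' = {#a, b, k#}) \<or>
     (0 < a \<or> 0 < b \<or> 0 < c) \<and> M' = {#a div 2, b div 2, c div 2#}"
  (is "_ \<longleftrightarrow> ?R")
proof
  assume "halve_nim_move {#a, b, c#} M'"
  then show ?R
  proof cases
    case (remove k m M)
    have "m \<in># {#a, b, c#}" by (simp add: remove(1))
    then consider "m = a" | "m = b" | "m = c" by auto
    then show ?thesis
      using remove by cases (auto simp: add_mset_commute)
  next
    case halve
    then show ?thesis by auto
  qed
next
  have "halve_nim_move {#a, b, c#} {#k, b, c#}" if "k < a" for k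
    using that by (rule halve_nim_move.remove)
  moreover have "halve_nim_move {#a, b, c#} {#a, k, c#}" if "k < b" for k
    using halve_nim_move.remove[OF that, of "{#a, c#}"] by (simp add: add_mset_commute)
  moreover have "halve_nim_move {#a, b, c#} {#a, b, k#}" if "k < c" for k
    using halve_nim_move.remove[OF that, of "{#a, b#}"] by (simp add: add_mset_commute)
  moreover have "halve_nim_move {#a, b, c#} {#a div 2, b div 2, c div 2#}" if "0 < a \<or> 0 < b \<or> 0 < c"
    using that halve_nim_move.halve[of "{#a, b, c#}"] by auto
  moreover assume ?R
  ultimately show "halve_nim_move {#a, b, c#} M'" by blast
qed

lemma sum_mset_div_less:
  fixes M :: "nat multiset"
  assumes "m \<in># M" "0 < m"
  shows "sum_mset (image_mset (\<lambda>m. m div 2) M) < sum_mset M"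
proof -
  obtain N where M: "M = add_mset m N"
    using assms(1) by (auto dest: multi_member_split)
  have "sum_mset (image_mset (\<lambda>m. m div 2) N) \<le> sum_mset N"
    using sum_mset_mono[of N "\<lambda>m. m div 2" "\<lambda>m. m"] by simp
  moreover have "m div 2 < m" using assms(2) by simp
  ultimately show ?thesis unfolding M by (simp add: add_less_le_mono)
qed

lemma halve_nim_move_sum_mset_less:
  "halve_nim_move M M' \<Longrightarrow> sum_mset M' < sum_mset M"
  by (induction rule: halve_nim_move.induct) (auto intro: sum_mset_div_less)

text \<open>For least fixed points this needs termination: every move lowers the number of
  coins.\<close>

lemma N_position_iff: "N_position M \<longleftrightarrow> \<not> P_position M"
proof (induction "sum_mset M" arbitrary: M rule: less_induct)
  case less
  have IH: "N_position M' \<longleftrightarrow> \<not> P_position M'" if "halve_nim_move M M'" for M'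
    using less halve_nim_move_sum_mset_less[OF that] by blast
  show ?case
    using IH by (subst N_position.simps, subst P_position.simps) blast
qed

lemma P_position_iff: "P_position M \<longleftrightarrow> (\<forall>M'. halve_nim_move M M' \<longrightarrow> \<not> P_position M')"
  by (subst P_position.simps) (auto simp: N_position_iff)

text \<open>Moves never raise the third pile, so rows below 6 form a closed system, and
  \<open>phi_mex\<close> is its recursion.\<close>

lemma P_position_triple:
  "c < 6 \<Longrightarrow> P_position {#a, b, c#} \<longleftrightarrow> b = phi c a"
proof (induction "a + b + c" arbitrary: a b c rule: less_induct)
  case less
  have IH: "P_position {#a', b', c'#} \<longleftrightarrow> b' = phi c' a'" if "a' + b' + c' < a + b + c" "c' < 6" for a' b' c'
    using less that by blast
  have remove_a: "P_position {#k, b, c#} \<longleftrightarrow> b = phi c k" if "k < a" for k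
    using that less.prems by (intro IH) simp_all
  have remove_b: "P_position {#a, k, c#} \<longleftrightarrow> k = phi c a" if "k < b" for k
    using that less.prems by (intro IH) simp_all
  have remove_c: "P_position {#a, b, k#} \<longleftrightarrow> b = phi k a" if "k < c" for k
    using that less.prems by (intro IH) simp_all
  have halve: "P_position {#a div 2, b div 2, c div 2#} \<longleftrightarrow> b div 2 = phi (c div 2) (a div 2)"
    if "0 < a \<or> 0 < b \<or> 0 < c"
  proof (rule IH)
    show "a div 2 + b div 2 + c div 2 < a + b + c"
      using that by linarith
    show "c div 2 < 6"
      using less.prems by simp
  qed
  have "P_position {#a, b, c#} \<longleftrightarrow>
      (\<forall>k<a. \<not> P_position {#k, b, c#}) \<and> (\<forall>k<b. \<not> P_position {#a, k, c#}) \<and>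
      (\<forall>k<c. \<not> P_position {#a, b, k#}) \<and>
      (0 < a \<or> 0 < b \<or> 0 < c \<longrightarrow> \<not> P_position {#a div 2, b div 2, c div 2#})"
    by (subst P_position_iff, unfold halve_nim_move_triple) blast
  also have "\<dots> \<longleftrightarrow>
      (\<forall>k<a. b \<noteq> phi c k) \<and> (\<forall>k<b. k \<noteq> phi c a) \<and> (\<forall>k<c. b \<noteq> phi k a) \<and>
      (0 < a \<or> 0 < b \<or> 0 < c \<longrightarrow> b div 2 \<noteq> phi (c div 2) (a div 2))"
    by (simp add: remove_a remove_b remove_c halve)
  also have "\<dots> \<longleftrightarrow> b = phi c a"
    by (rule phi_mex[OF less.prems, symmetric])
  finally show ?case .
qed

section \<open>The row with third pile 5\<close>

lemma phi5_eq: "phi5 x = phi 5 x"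
  using int_phi5[of x] 
  by (auto simp: phi5_def phi_def phi_table_def shifted_xor_def)

theorem theorem29:
  shows "(\<forall>a b :: nat. P_position {#a, b, 5#} \<longleftrightarrow> b = phi5 a) \<and>
         (\<forall>a b :: nat. 30 \<le> a \<longrightarrow> 30 \<le> b \<longrightarrow>
            (P_position {#a, b, 5#} \<longleftrightarrow> xor (a + 2) (b + 2) = 3))"
proof -
  have P: "P_position {#a, b, 5#} \<longleftrightarrow> b = phi5 a" for a b
    using P_position_triple[of 5 a b] by (simp add: phi5_eq)
  have "b = phi5 a \<longleftrightarrow> xor (a + 2) (b + 2) = 3" if "30 \<le> a" for a b
  proof -
    have "b = phi5 a \<longleftrightarrow> b + 2 = xor (a + 2) 3"
      using int_phi5[OF that] unfolding shifted_xor_def by linarith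
    also have "\<dots> \<longleftrightarrow> xor (a + 2) (b + 2) = 3"
      by (metis xor.assoc xor.left_neutral xor_self_eq)
    finally show ?thesis .
  qed
  with P show ?thesis by blast
qed

end
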